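(* Consider the CBC-process with parameters $(b,c,\mu,g)$ and its operator $L$. Assume that for some $\alpha\in(0,2)$ and $c_0>0$ the restriction of $\mu$ to $(1,\infty)$ is absolutely continuous with respect to Lebesgue measure with density satisfying $$\frac{\mathbf 1_{\{z>1\}}\mu(dz)}{dz}\le c_0z^{-1-\alpha}.$$ Let $\varphi\in C^1[0,\infty)$ be an increasing and strictly positive function satisfying $\int_1^\infty\frac{1}{r\varphi(r)}\,dr<\infty$. Suppose that the condition corresponding to the value of $\alpha$ holds: $$\begin{cases}\displaystyle\lim_{x\to\infty}\frac{g(x)}{x\varphi(x)}=\infty & \text{if } \alpha\in(1,2),\\[2mm] \displaystyle\lim_{x\to\infty}\frac{g(x)}{x\varphi(x)\log x}=\infty & \text{if } \alpha=1,\\[2mm] \displaystyle\lim_{x\to\infty}\frac{g(x)}{x^{2-\alpha}}=\infty & \text{if } \alpha\in(0,1).\end{cases}$$ Then the following Lyapunov condition is satisfied: there exist a function $W\in C_b^2[0,\infty)$ with $W(x)\ge1$ for all $x\in[0,\infty)$, two sequences of positive constants $(r_n)_{n\ge1}$ and $(b_n)_{n\ge1}$ with $r_n\to\infty$ as $n\to\infty$, and an increasing sequence of compact subsets $(K_n)_{n\ge1}$ of $[0,\infty)$, such that for all $n\ge1$, $$-LW(x)\ge r_nW(x)-b_n\mathbf 1_{K_n}(x),\quad x\in[0,\infty).$$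
   Context: Setting. Let $b\in\mathbb R$, $c\ge 0$, let $\mu$ be a measure on $(0,\infty)$ such that $(1\wedge z^2)\mu(dz)$ is a finite measure, and let $g:[0,\infty)\to[0,\infty)$ be continuous and non-decreasing with $g(0)=0$. The CBC-process (continuous-state branching process with competition) with these parameters is the $[0,\infty)$-valued strong solution (assumed throughout to exist uniquely and be non-explosive) to $$Y_t=Y_0+\sqrt{2c}\int_0^t\!\int_0^{Y_{s-}}W_0(ds,du)-\int_0^t[bY_s+g(Y_s)]ds+\int_0^t\!\int_0^1\!\int_0^{Y_{s-}}z\,\tilde M(ds,dz,du)+\int_0^t\!\int_1^\infty\!\int_0^{Y_{s-}}z\,M(ds,dz,du),$$ where, on a filtered probability space satisfying the usual hypotheses, $W_0$ is a Gaussian white noise on $(0,\infty)^2$ based on $ds\,du$, $M$ is a Poisson random measure on $(0,\infty)^3$ with intensity $ds\,\mu(dz)\,du$, and $\tilde M$ is its compensated measure. Its operator is $$Lf(x)=-[bx+g(x)]f'(x)+cxf''(x)+x\int_0^\infty\big[f(x+z)-f(x)-zf'(x)\mathbf 1_{\{z\le1\}}\big]\mu(dz),\quad x\in[0,\infty).$$ $C_b^2[0,\infty)$ is the space of bounded twice continuously differentiable functions on $[0,\infty)$ with bounded first and second derivatives. *)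

theory Defs
  imports "HOL-Analysis.Analysis"
begin

text \<open>Functions on the closed half-line are represented by functions on the whole real line of
  which only the values on \<open>{0..}\<close> matter.  All derivatives are taken within \<open>{0..}\<close>, so that
  the derivative at 0 is the one-sided one.\<close>

definition deriv_halfline :: "(real \<Rightarrow> real) \<Rightarrow> real \<Rightarrow> real" where
  "deriv_halfline f x = vector_derivative f (at x within {0..})"

definition C1_halfline :: "(real \<Rightarrow> real) set" where
  "C1_halfline = {f. f differentiable_on {0..} \<and> continuous_on {0..} (deriv_halfline f)}"

definition Cb2_halfline :: "(real \<Rightarrow> real) set" where
  "Cb2_halfline = {f. f \<in> C1_halfline \<and> deriv_halfline f \<in> C1_halfline \<and>
     bounded (f ` {0..}) \<and> bounded (deriv_halfline f ` {0..}) \<and>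
     bounded (deriv_halfline (deriv_halfline f) ` {0..})}"

text \<open>Admissible parameters of a continuous-state branching process with competition; the
  linear drift coefficient is an arbitrary real and hence not among them.  The jump
  measure has the open half-line as its underlying space.\<close>

locale cbc_parameters =
  fixes c :: real and \<mu> :: "real measure" and g :: "real \<Rightarrow> real"
  assumes c_nonneg: "0 \<le> c"
    and sets_mu: "sets \<mu> = sets (restrict_space borel {0<..})"
    and finite_mu: "finite_measure (density \<mu> (\<lambda>z. ennreal (min 1 (z\<^sup>2))))"
    and g_nonneg: "\<And>x. 0 \<le> x \<Longrightarrow> 0 \<le> g x"
    and g_continuous: "continuous_on {0..} g"
    and g_mono: "mono_on {0..} g"
    and g_zero: "g 0 = 0"

text \<open>The operator \<open>L\<close> of the process.  For admissible parameters and \<open>f\<close> in \<open>Cb2_halfline\<close> the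
  integrand is dominated by a multiple of \<open>min 1 (z\<^sup>2)\<close>, so the Bochner integral is a genuine one.\<close>

definition cbc_operator ::
  "real \<Rightarrow> real \<Rightarrow> real measure \<Rightarrow> (real \<Rightarrow> real) \<Rightarrow> (real \<Rightarrow> real) \<Rightarrow> real \<Rightarrow> real" where
  "cbc_operator b c \<mu> g f x =
     - (b * x + g x) * deriv_halfline f x
     + c * x * deriv_halfline (deriv_halfline f) x
     + x * (LINT z|\<mu>. f (x + z) - f x - z * deriv_halfline f x * indicator {..1} z)"

end

theory Submission
  imports Defs
begin

text \<open>
  Take \<open>W\<close> bounded, increasing and concave.  Then two of the terms of \<open>L W\<close> have a sign that helps:
  the diffusion term \<open>c x W''(x)\<close> and the jumps of size at most 1, whose compensated increments are
  nonpositive by concavity.  The linear drift costs at most a multiple of \<open>x W'(x)\<close>, which is kept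
  bounded.  What remains is a competition between the drift \<open>g(x) W'(x)\<close>, which pulls down, and the
  jumps of size above 1, which push up.

  For the jumps there are two bounds on \<open>W (x + z) - W x\<close>: concavity gives \<open>z W'(x)\<close>, and
  boundedness by \<open>M\<close> gives \<open>M - W x\<close>.  Using the first for \<open>z \<le> s\<close>, the second for \<open>z > s\<close>, and
  the bound on the density of the jump measure yields
  \[ x \int_1^\infty (W(x+z) - W(x))\,\mu(dz)
     \le c_0\, x \left( W'(x) \int_1^s z^{-\alpha}\,dz + (M - W(x)) \frac{s^{-\alpha}}{\alpha} \right). \]
  The choice \<open>s = 1\<close> shows that \<open>L W\<close> grows at most linearly; the choice \<open>s = x\<close> is used for
  \<open>x \<longlonglongrightarrow> \<infinity>\<close>.  This is \<open>cbc_operator_le\<close>.  Only upper bounds on \<open>L W\<close> are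
  wanted, so the jump integral can be estimated by a nonnegative integral of its positive part.

  For \<open>\<alpha> \<ge> 1\<close> the natural choice is \<open>W'(x) = 1 / (x \<phi>(x))\<close> for large \<open>x\<close>: it is integrable, so \<open>W\<close> is
  bounded, and \<open>g W'\<close> is the quantity assumed to tend to infinity, with a spare factor \<open>ln x\<close>
  when \<open>\<alpha> = 1\<close> to beat the logarithm in \<open>\<integral> z\<^sup>-\<^sup>1 dz\<close>.  However, \<open>W''\<close> would then contain
  \<open>\<phi>' / (x \<phi>\<^sup>2)\<close>, which can be unbounded.  Instead \<open>W'(x)\<close> is the mean of that function over
  \<open>[x - 1, x]\<close>.  The mean still dominates its value at the right end point, so the drift does not
  suffer, and \<open>W''\<close> becomes a difference of two values of a bounded function
  (\<open>smoothed_concave_function\<close>).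

  For \<open>\<alpha> < 1\<close> the explicit \<open>W x = 2 - (1 + x)\<^sup>\<alpha>\<^sup>-\<^sup>1\<close> balances the two jump contributions: both stay
  bounded, whereas \<open>g W'\<close> is of the order of \<open>g x / x\<^sup>2\<^sup>-\<^sup>\<alpha>\<close>.

  Once \<open>L W\<close> tends to \<open>-\<infinity>\<close> and is bounded above on compact sets, the sequences of the Lyapunov condition
  are read off with \<open>r n = n\<close> and \<open>K n = [0, \<rho> n]\<close> (\<open>lyapunov_conditionI\<close>).
\<close>

section \<open>Calculus on the closed half-line\<close>

lemma deriv_halfline_eq:
  assumes "(f has_real_derivative D) (at x within {0..})" and "0 \<le> x"
  shows "deriv_halfline f x = D"
proof -
  have "at_right x \<le> at x within {0..}"
    using \<open>0 \<le> x\<close> by (intro at_le) auto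
  then have "at x within {0..} \<noteq> bot"
    using trivial_limit_at_right_real[of x] by (auto simp: bot_unique)
  then show ?thesis
    unfolding deriv_halfline_def
    using assms by (intro vector_derivative_within)
      (auto simp: has_real_derivative_iff_has_vector_derivative)
qed

lemma deriv_halfline_has_real_derivative:
  assumes d1: "\<And>x. 0 \<le> x \<Longrightarrow> (f has_real_derivative d x) (at x within {0..})"
    and d2: "(d has_real_derivative e) (at x within {0..})" and "0 \<le> x"
  shows "(deriv_halfline f has_real_derivative e) (at x within {0..})"
  by (rule has_field_derivative_transform_within[OF d2 zero_less_one])
     (use \<open>0 \<le> x\<close> in \<open>auto simp: deriv_halfline_eq[OF d1]\<close>)

lemma C1_halflineI:
  assumes der: "\<And>x. 0 \<le> x \<Longrightarrow> (f has_real_derivative d x) (at x within {0..})"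
    and cont: "continuous_on {0..} d"
  shows "f \<in> C1_halfline"
proof -
  have "f differentiable_on {0..}"
    using der unfolding differentiable_on_def
    by (auto simp: real_differentiable_def)
  moreover have "continuous_on {0..} (deriv_halfline f)"
    using cont by (rule continuous_on_eq) (simp add: deriv_halfline_eq[OF der])
  ultimately show ?thesis
    by (simp add: C1_halfline_def)
qed

lemma Cb2_halflineI:
  assumes d1: "\<And>x. 0 \<le> x \<Longrightarrow> (f has_real_derivative d x) (at x within {0..})"
    and d2: "\<And>x. 0 \<le> x \<Longrightarrow> (d has_real_derivative e x) (at x within {0..})"
    and cont: "continuous_on {0..} e"
    and bdd: "bounded (f ` {0..})" "bounded (d ` {0..})" "bounded (e ` {0..})"
  shows "f \<in> Cb2_halfline"
proof -
  have eq1: "deriv_halfline f x = d x" if "0 \<le> x" for x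
    using d1 that by (intro deriv_halfline_eq)
  have d2': "(deriv_halfline f has_real_derivative e x) (at x within {0..})" if "0 \<le> x" for x
    using d1 d2[OF that] that by (rule deriv_halfline_has_real_derivative)
  have eq2: "deriv_halfline (deriv_halfline f) x = e x" if "0 \<le> x" for x
    using d2' that by (intro deriv_halfline_eq)
  have "continuous_on {0..} d"
    using d2 by (auto intro!: DERIV_continuous_on)
  then have "f \<in> C1_halfline" "deriv_halfline f \<in> C1_halfline"
    using d1 d2' cont by (auto intro: C1_halflineI)
  moreover have "deriv_halfline f ` {0..} = d ` {0..}"
    "deriv_halfline (deriv_halfline f) ` {0..} = e ` {0..}"
    by (auto simp: eq1 eq2)
  ultimately show ?thesis
    using bdd by (simp add: Cb2_halfline_def)
qed

text \<open>An antiderivative on the whole line lets bounds be proved by the mean value theorem and by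
  monotonicity, without interval integrals.\<close>

lemma real_antiderivative:
  fixes f :: "real \<Rightarrow> real"
  assumes "continuous_on UNIV f"
  obtains F where "\<And>x. (F has_real_derivative f x) (at x)"
proof -
  have "\<exists>F. \<forall>x :: real. - \<infinity> < ereal x \<longrightarrow> ereal x < \<infinity> \<longrightarrow> (F has_vector_derivative f x) (at x)"
    using assms by (intro einterval_antiderivative)
      (auto simp: continuous_on_eq_continuous_at)
  then show ?thesis
    using that by (auto simp: has_real_derivative_iff_has_vector_derivative)
qed

lemma halfline_mean_value:
  assumes der: "\<And>x. 0 \<le> x \<Longrightarrow> (f has_real_derivative d x) (at x within {0..})"
    and "0 \<le> x" "x \<le> y"
  obtains \<xi> where "x \<le> \<xi>" "\<xi> \<le> y" "f y - f x = d \<xi> * (y - x)"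
proof -
  have "\<exists>\<xi>\<in>{x..y}. f y - f x = d \<xi> * (y - x)"
  proof (rule mvt_very_simple[OF \<open>x \<le> y\<close>])
    fix t assume "x \<le> t" "t \<le> y"
    then have "(f has_real_derivative d t) (at t within {x..y})"
      using \<open>0 \<le> x\<close> by (intro has_field_derivative_subset[OF der]) auto
    then show "(f has_derivative (*) (d t)) (at t within {x..y})"
      by (simp add: has_field_derivative_def)
  qed
  then show ?thesis
    using that by auto
qed

section \<open>Upper bounds for the operator on concave functions\<close>

text \<open>The integral of \<open>z powr (- \<alpha>)\<close> over \<open>[1, s]\<close>.\<close>

definition power_primitive :: "real \<Rightarrow> real \<Rightarrow> real" where
  "power_primitive \<alpha> s = (if \<alpha> = 1 then ln s else (s powr (1 - \<alpha>) - 1) / (1 - \<alpha>))"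

lemma power_primitive_1 [simp]: "power_primitive \<alpha> 1 = 0"
  by (simp add: power_primitive_def)

lemma power_primitive_deriv:
  assumes "0 < x"
  shows "(power_primitive \<alpha> has_real_derivative x powr (- \<alpha>)) (at x)"
proof (cases "\<alpha> = 1")
  case True
  then show ?thesis
    using assms unfolding power_primitive_def[abs_def]
    by (auto intro!: derivative_eq_intros simp: powr_minus field_simps)
next
  case False
  then show ?thesis
    using assms unfolding power_primitive_def[abs_def]
    by (auto intro!: derivative_eq_intros)
qed

lemma power_primitive_nonneg:
  assumes "1 \<le> s"
  shows "0 \<le> power_primitive \<alpha> s"
proof -
  have "power_primitive \<alpha> 1 \<le> power_primitive \<alpha> s"
  proof (rule DERIV_nonneg_imp_nondecreasing[OF assms])
    fix x :: real assume "1 \<le> x" "x \<le> s"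
    then show "\<exists>y. (power_primitive \<alpha> has_real_derivative y) (at x) \<and> 0 \<le> y"
      by (intro exI[of _ "x powr (- \<alpha>)"] conjI power_primitive_deriv) auto
  qed
  then show ?thesis by simp
qed

text \<open>The integrand majorises the increments of a concave bounded function against the power-law
  density: linear growth with slope \<open>d\<close> up to the cut-off \<open>s\<close>, the constant \<open>D\<close> beyond it.\<close>

lemma nn_integral_truncated_power:
  fixes \<alpha> c\<^sub>0 d D s :: real
  assumes "0 < \<alpha>" "0 \<le> c\<^sub>0" "0 \<le> d" "0 \<le> D" "1 \<le> s"
  shows "(\<integral>\<^sup>+z. ennreal (if z \<le> s then d * z else D) * ennreal (c\<^sub>0 * z powr (- 1 - \<alpha>)) *
             indicator {1<..} z \<partial>lborel)
         \<le> ennreal (c\<^sub>0 * (d * power_primitive \<alpha> s + D * s powr (- \<alpha>) / \<alpha>))"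
    (is "?I \<le> _")
proof -
  have near: "(\<integral>\<^sup>+z. ennreal (c\<^sub>0 * d * z powr (- \<alpha>)) * indicator {1..s} z \<partial>lborel)
      = ennreal (c\<^sub>0 * d * power_primitive \<alpha> s - c\<^sub>0 * d * power_primitive \<alpha> 1)"
    using assms
    by (intro nn_integral_FTC_Icc)
       (auto intro!: derivative_eq_intros power_primitive_deriv)
  have far: "(\<integral>\<^sup>+z. ennreal (c\<^sub>0 * D * z powr (- 1 - \<alpha>)) * indicator {s..} z \<partial>lborel)
      = ennreal (0 - - (c\<^sub>0 * D * s powr (- \<alpha>) / \<alpha>))"
  proof (rule nn_integral_FTC_atLeast)
    fix x :: real assume "s \<le> x"
    then show "((\<lambda>x. - (c\<^sub>0 * D * x powr (- \<alpha>) / \<alpha>)) has_real_derivative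
        c\<^sub>0 * D * x powr (- 1 - \<alpha>)) (at x)"
    proof -
      have "0 < x" using \<open>s \<le> x\<close> assms by simp
      then show ?thesis
        using \<open>0 < \<alpha>\<close> by (auto intro!: derivative_eq_intros simp: minus_diff_commute)
    qed
  next
    have "((\<lambda>x. c\<^sub>0 * D * x powr (- \<alpha>) / \<alpha>) \<longlongrightarrow> c\<^sub>0 * D * 0 / \<alpha>) at_top"
      using assms by (intro tendsto_intros tendsto_neg_powr filterlim_ident) auto
    then show "((\<lambda>x. - (c\<^sub>0 * D * x powr (- \<alpha>) / \<alpha>)) \<longlongrightarrow> 0) at_top"
      using tendsto_minus by fastforce
  qed (use assms in auto)
  have "?I \<le> (\<integral>\<^sup>+z. ennreal (c\<^sub>0 * d * z powr (- \<alpha>)) * indicator {1..s} z +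
                  ennreal (c\<^sub>0 * D * z powr (- 1 - \<alpha>)) * indicator {s..} z \<partial>lborel)"
  proof (rule nn_integral_mono)
    fix z :: real
    have *: "d * z * (c\<^sub>0 * z powr (- 1 - \<alpha>)) = c\<^sub>0 * d * z powr (- \<alpha>)" if "1 < z"
      using that powr_mult_base[of z "- 1 - \<alpha>"] by simp
    consider "z \<le> 1" | "1 < z" "z \<le> s" | "1 < z" "s < z" by linarith
    then show "ennreal (if z \<le> s then d * z else D) * ennreal (c\<^sub>0 * z powr (- 1 - \<alpha>)) *
             indicator {1<..} z
        \<le> ennreal (c\<^sub>0 * d * z powr (- \<alpha>)) * indicator {1..s} z +
          ennreal (c\<^sub>0 * D * z powr (- 1 - \<alpha>)) * indicator {s..} z"
    proof cases
      case 2
      have "ennreal (d * z) * ennreal (c\<^sub>0 * z powr (- 1 - \<alpha>)) = ennreal (c\<^sub>0 * d * z powr (- \<alpha>))"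
        using assms 2 by (subst ennreal_mult[symmetric]) (auto simp only: * mult_nonneg_nonneg powr_ge_zero)
      then show ?thesis
        using 2 by (simp add: indicator_def)
    next
      case 3
      have "ennreal D * ennreal (c\<^sub>0 * z powr (- 1 - \<alpha>)) = ennreal (c\<^sub>0 * D * z powr (- 1 - \<alpha>))"
        using assms by (subst ennreal_mult[symmetric]) (simp_all add: mult_ac)
      then show ?thesis
        using 3 by (simp add: indicator_def)
    qed simp
  qed
  also have "\<dots> = ennreal (c\<^sub>0 * d * power_primitive \<alpha> s) + ennreal (c\<^sub>0 * D * s powr (- \<alpha>) / \<alpha>)"
    using near far by (subst nn_integral_add) auto
  also have "\<dots> = ennreal (c\<^sub>0 * (d * power_primitive \<alpha> s + D * s powr (- \<alpha>) / \<alpha>))"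
    using assms power_primitive_nonneg[of s \<alpha>]
    by (subst ennreal_plus[symmetric]) (auto simp: algebra_simps)
  finally show ?thesis .
qed

lemma nn_integral_large_jumps_le:
  fixes \<mu> :: "real measure"
  assumes sets: "sets \<mu> = sets (restrict_space borel {0<..})"
    and p: "p \<in> borel_measurable (restrict_space lborel {1<..})"
    and dens: "restrict_space \<mu> {1<..} = density (restrict_space lborel {1<..}) p"
    and bound: "AE z in restrict_space lborel {1<..}. p z \<le> q z"
    and H: "H \<in> borel_measurable borel"
  shows "(\<integral>\<^sup>+z. H z * indicator {1<..} z \<partial>\<mu>) \<le> (\<integral>\<^sup>+z. H z * q z * indicator {1<..} z \<partial>lborel)"
proof -
  have "{1<..} \<inter> space \<mu> \<in> sets \<mu>"
    by (auto simp: sets sets_eq_imp_space_eq[OF sets] space_restrict_space sets_restrict_space)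
  then have "(\<integral>\<^sup>+z. H z * indicator {1<..} z \<partial>\<mu>) = (\<integral>\<^sup>+z. H z \<partial>restrict_space \<mu> {1<..})"
    by (simp add: nn_integral_restrict_space)
  also have "\<dots> = (\<integral>\<^sup>+z. p z * H z \<partial>restrict_space lborel {1<..})"
    using p H unfolding dens
    by (intro nn_integral_density) (auto intro!: measurable_restrict_space1)
  also have "\<dots> \<le> (\<integral>\<^sup>+z. H z * q z \<partial>restrict_space lborel {1<..})"
    using bound by (intro nn_integral_mono_AE)
      (auto elim!: eventually_mono simp: mult.commute intro: mult_left_mono)
  also have "\<dots> = (\<integral>\<^sup>+z. H z * q z * indicator {1<..} z \<partial>lborel)"
    by (simp add: nn_integral_restrict_space)
  finally show ?thesis .
qed

text \<open>The negative part of \<open>f\<close> only lowers a genuine integral, and a non-integrable \<open>f\<close> has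
  integral 0 by convention; this is why \<open>0 \<le> T\<close> is required.\<close>

lemma integral_le_of_nn_integral_le:
  fixes f :: "'a \<Rightarrow> real"
  assumes "(\<integral>\<^sup>+x. ennreal (f x) \<partial>M) \<le> ennreal T" and "0 \<le> T"
  shows "integral\<^sup>L M f \<le> T"
proof (cases "integrable M f")
  case True
  have "integral\<^sup>L M f \<le> enn2real (\<integral>\<^sup>+x. ennreal (f x) \<partial>M)"
    unfolding real_lebesgue_integral_def[OF True] by simp
  also have "\<dots> \<le> T"
    using assms by (simp add: enn2real_leI)
  finally show ?thesis .
qed (use assms in \<open>simp add: not_integrable_integral_eq\<close>)

text \<open>Candidates for the Lyapunov function.  The derivatives \<open>d\<close> and \<open>e\<close> are parameters, so that their
  values can be used without recourse to the one-sided derivative operator.\<close>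

locale concave_test_function =
  fixes W d e :: "real \<Rightarrow> real" and M E :: real
  assumes deriv_W: "\<And>x. 0 \<le> x \<Longrightarrow> (W has_real_derivative d x) (at x within {0..})"
    and deriv_d: "\<And>x. 0 \<le> x \<Longrightarrow> (d has_real_derivative e x) (at x within {0..})"
    and e_continuous: "continuous_on {0..} e"
    and d_nonneg: "\<And>x. 0 \<le> x \<Longrightarrow> 0 \<le> d x"
    and e_nonpos: "\<And>x. 0 \<le> x \<Longrightarrow> e x \<le> 0"
    and e_ge: "\<And>x. 0 \<le> x \<Longrightarrow> - E \<le> e x"
    and W_0: "1 \<le> W 0"
    and W_le: "\<And>x. 0 \<le> x \<Longrightarrow> W x \<le> M"
begin

lemma d_antimono:
  assumes "0 \<le> x" "x \<le> y"
  shows "d y \<le> d x"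
proof -
  obtain \<xi> where "x \<le> \<xi>" "d y - d x = e \<xi> * (y - x)"
    using halfline_mean_value[OF deriv_d assms] by blast
  then show ?thesis
    using e_nonpos[of \<xi>] assms mult_nonpos_nonneg[of "e \<xi>" "y - x"] by auto
qed

lemma increment_le:
  assumes "0 \<le> x" "0 \<le> z"
  shows "W (x + z) - W x \<le> d x * z"
proof -
  have "x \<le> x + z" using assms by simp
  then obtain \<xi> where "x \<le> \<xi>" "W (x + z) - W x = d \<xi> * (x + z - x)"
    using halfline_mean_value[OF deriv_W \<open>0 \<le> x\<close>] by blast
  then show ?thesis
    using d_antimono[of x \<xi>] assms by (auto intro: mult_right_mono)
qed

lemma W_ge_1:
  assumes "0 \<le> x"
  shows "1 \<le> W x"
proof -
  obtain \<xi> where "0 \<le> \<xi>" "W x - W 0 = d \<xi> * (x - 0)"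
    using halfline_mean_value[OF deriv_W order_refl assms] by blast
  moreover from \<open>0 \<le> \<xi>\<close> have "0 \<le> d \<xi> * (x - 0)"
    using d_nonneg assms by simp
  ultimately show ?thesis
    using W_0 by linarith
qed

lemma M_ge_1: "1 \<le> M"
  using W_0 W_le[of 0] by simp

lemma W_in_Cb2: "W \<in> Cb2_halfline"
proof (rule Cb2_halflineI[OF deriv_W deriv_d e_continuous])
  show "bounded (W ` {0..})"
    using W_ge_1 W_le by (intro boundedI[of _ M]) force
  show "bounded (d ` {0..})"
    using d_nonneg d_antimono[of 0] by (intro boundedI[of _ "d 0"]) force
  show "bounded (e ` {0..})"
    using e_nonpos e_ge by (intro boundedI[of _ E]) force
qed auto

lemma deriv_halfline_W: "0 \<le> x \<Longrightarrow> deriv_halfline W x = d x"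
  by (intro deriv_halfline_eq deriv_W)

lemma deriv_halfline_deriv_halfline_W: "0 \<le> x \<Longrightarrow> deriv_halfline (deriv_halfline W) x = e x"
  using deriv_W deriv_d by (intro deriv_halfline_eq deriv_halfline_has_real_derivative)

end

locale cbc_power_tail = cbc_parameters c \<mu> g
  for c :: real and \<mu> :: "real measure" and g :: "real \<Rightarrow> real" +
  fixes \<alpha> c\<^sub>0 :: real and p :: "real \<Rightarrow> ennreal"
  assumes alpha_pos: "0 < \<alpha>" and c0_pos: "0 < c\<^sub>0"
    and p_measurable: "p \<in> borel_measurable (restrict_space lborel {1<..})"
    and tail_density: "restrict_space \<mu> {1<..} = density (restrict_space lborel {1<..}) p"
    and p_le: "AE z in restrict_space lborel {1<..}. p z \<le> ennreal (c\<^sub>0 * z powr (- 1 - \<alpha>))"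

locale cbc_concave = cbc_power_tail c \<mu> g \<alpha> c\<^sub>0 p + concave_test_function W d e M E
  for c \<mu> g \<alpha> c\<^sub>0 p W d e M E
begin

text \<open>Jumps with \<open>z \<le> 1\<close> contribute \<open>W (x + z) - W x - z * d x \<le> 0\<close>, so they vanish from the
  nonnegative integral; larger ones are bounded by concavity up to \<open>s\<close> and by \<open>M\<close> beyond.\<close>

lemma jump_integral_le:
  assumes "0 \<le> x" "1 \<le> s"
  shows "(LINT z|\<mu>. W (x + z) - W x - z * deriv_halfline W x * indicator {..1} z)
    \<le> c\<^sub>0 * (d x * power_primitive \<alpha> s + (M - W x) * s powr (- \<alpha>) / \<alpha>)"
    (is "_ \<le> ?T")
proof (rule integral_le_of_nn_integral_le)
  define H where "H z = ennreal (if z \<le> s then d x * z else M - W x)" for z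
  have H: "H \<in> borel_measurable borel"
    unfolding H_def by measurable
  have "(\<integral>\<^sup>+z. ennreal (W (x + z) - W x - z * deriv_halfline W x * indicator {..1} z) \<partial>\<mu>)
      \<le> (\<integral>\<^sup>+z. H z * indicator {1<..} z \<partial>\<mu>)"
  proof (rule nn_integral_mono)
    fix z assume "z \<in> space \<mu>"
    then have "0 < z"
      by (simp add: sets_eq_imp_space_eq[OF sets_mu] space_restrict_space)
    then show "ennreal (W (x + z) - W x - z * deriv_halfline W x * indicator {..1} z)
        \<le> H z * indicator {1<..} z"
      using increment_le[of x z] W_le[of "x + z"] \<open>0 \<le> x\<close>
      by (auto simp: H_def indicator_def deriv_halfline_W ennreal_neg mult.commute
               intro!: ennreal_leI)
  qed
  also have "\<dots> \<le> (\<integral>\<^sup>+z. H z * ennreal (c\<^sub>0 * z powr (- 1 - \<alpha>)) * indicator {1<..} z \<partial>lborel)"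
    by (intro nn_integral_large_jumps_le[OF sets_mu p_measurable tail_density p_le H])
  also have "\<dots> \<le> ennreal ?T"
    unfolding H_def
    using alpha_pos c0_pos d_nonneg W_le assms by (intro nn_integral_truncated_power) auto
  finally show "(\<integral>\<^sup>+z. ennreal (W (x + z) - W x - z * deriv_halfline W x * indicator {..1} z) \<partial>\<mu>)
      \<le> ennreal ?T" .
  show "0 \<le> ?T"
    using alpha_pos c0_pos d_nonneg[of x] W_le[of x] assms power_primitive_nonneg[of s \<alpha>]
    by auto
qed

lemma cbc_operator_le:
  assumes "0 \<le> x" "1 \<le> s"
  shows "cbc_operator b c \<mu> g W x \<le> - (b * x + g x) * d x
    + x * (c\<^sub>0 * (d x * power_primitive \<alpha> s + (M - W x) * s powr (- \<alpha>) / \<alpha>))"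
proof -
  have "c * x * e x \<le> 0"
    using c_nonneg \<open>0 \<le> x\<close> e_nonpos by (simp add: mult_nonneg_nonpos)
  moreover have "x * (LINT z|\<mu>. W (x + z) - W x - z * deriv_halfline W x * indicator {..1} z)
      \<le> x * (c\<^sub>0 * (d x * power_primitive \<alpha> s + (M - W x) * s powr (- \<alpha>) / \<alpha>))"
    using assms by (intro mult_left_mono jump_integral_le)
  ultimately show ?thesis
    unfolding cbc_operator_def deriv_halfline_deriv_halfline_W[OF \<open>0 \<le> x\<close>]
    by (simp add: deriv_halfline_W[OF \<open>0 \<le> x\<close>])
qed

end

section \<open>From divergence at infinity to the Lyapunov condition\<close>

text \<open>The conclusion for a given operator value \<open>L\<close> (standing for \<open>L W\<close>) and test function \<open>W\<close>.\<close>

definition lyapunov_condition :: "(real \<Rightarrow> real) \<Rightarrow> (real \<Rightarrow> real) \<Rightarrow> bool" where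
  "lyapunov_condition L W \<longleftrightarrow>
    (\<exists>(r :: nat \<Rightarrow> real) (\<beta> :: nat \<Rightarrow> real) (K :: nat \<Rightarrow> real set).
      (\<forall>n\<ge>1. 0 < r n) \<and> (\<forall>n\<ge>1. 0 < \<beta> n) \<and> filterlim r at_top sequentially \<and>
      (\<forall>n\<ge>1. compact (K n) \<and> K n \<subseteq> {0..} \<and> K n \<subseteq> K (Suc n)) \<and>
      (\<forall>n\<ge>1. \<forall>x\<ge>0. - L x \<ge> r n * W x - \<beta> n * indicator (K n) x))"

text \<open>Since \<open>W \<le> M\<close>, it is enough to have \<open>- L x \<ge> n * M\<close> outside a compact set \<open>K n\<close>, which the limit
  provides; inside, the linear bound on \<open>L\<close> determines how large \<open>\<beta> n\<close> has to be.\<close>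

lemma lyapunov_conditionI:
  fixes L W :: "real \<Rightarrow> real"
  assumes lim: "filterlim (\<lambda>x. - L x) at_top at_top"
    and L_le: "\<And>x. 0 \<le> x \<Longrightarrow> L x \<le> u + v * x" and "0 \<le> u" "0 \<le> v"
    and W_le: "\<And>x. 0 \<le> x \<Longrightarrow> W x \<le> M" and "1 \<le> M"
  shows "lyapunov_condition L W"
proof -
  have "\<exists>R\<ge>0. \<forall>x\<ge>R. L x \<le> - (real n * M)" for n
  proof -
    have "\<forall>\<^sub>F x in at_top. real n * M \<le> - L x"
      using lim by (simp add: filterlim_at_top)
    then obtain R where "\<forall>x\<ge>R. real n * M \<le> - L x"
      by (auto simp: eventually_at_top_linorder)
    then show ?thesis
      by (intro exI[of _ "max 0 R"]) (auto simp: le_minus_iff)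
  qed
  then obtain R where R: "\<And>n. 0 \<le> R n" "\<And>n x. R n \<le> x \<Longrightarrow> L x \<le> - (real n * M)"
    by metis
  \<comment> \<open>Summing the radii makes the compact sets increasing and keeps \<open>R n \<le> \<rho> n\<close>.\<close>
  define \<rho> where "\<rho> n = (\<Sum>k\<le>n. R k)" for n
  have \<rho>: "R n \<le> \<rho> n" "0 \<le> \<rho> n" "\<rho> n \<le> \<rho> (Suc n)" for n
    using R(1) member_le_sum[of n "{..n}" R] by (auto simp: \<rho>_def intro: sum_nonneg)
  define \<beta> where "\<beta> n = real n * M + u + v * \<rho> n + 1" for n
  have "0 < \<beta> n" for n
    using \<rho>(2)[of n] assms(3,4,6) by (auto simp: \<beta>_def intro!: add_nonneg_pos add_nonneg_nonneg)
  moreover have "- L x \<ge> real n * W x - \<beta> n * indicator {0..\<rho> n} x" if "0 \<le> x" for n x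
  proof -
    have W: "real n * W x \<le> real n * M"
      using W_le[OF that] by (intro mult_left_mono) auto
    show ?thesis
    proof (cases "x \<le> \<rho> n")
      case True
      then have "v * x \<le> v * \<rho> n"
        using \<open>0 \<le> v\<close> by (intro mult_left_mono)
      then show ?thesis
        using W L_le[OF that] True that by (simp add: \<beta>_def)
    next
      case False
      then have "L x \<le> - (real n * M)"
        using \<rho>(1)[of n] by (intro R(2)) simp
      then show ?thesis
        using W False by simp
    qed
  qed
  ultimately show ?thesis
    unfolding lyapunov_condition_def using \<rho>
    by (intro exI[of _ real] exI[of _ \<beta>] exI[of _ "\<lambda>n. {0..\<rho> n}"])
       (auto simp: filterlim_real_sequentially intro: order_trans)
qed

text \<open>The limit hypothesis is the competition between drift and large jumps, with the cut-off \<open>s = x\<close>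
  in the jump bound.  This choice gives \<open>M - W x\<close> the factor \<open>x powr (1 - \<alpha>)\<close>, which is bounded for
  \<open>\<alpha> \<ge> 1\<close> and can be compensated by the decay of \<open>M - W x\<close> for \<open>\<alpha> < 1\<close>.\<close>

lemma (in cbc_concave) lyapunov_of_drift_domination:
  assumes d_le: "\<And>x. 0 \<le> x \<Longrightarrow> x * d x \<le> C"
    and lim: "filterlim (\<lambda>x. g x * d x - c\<^sub>0 * (x * d x * power_primitive \<alpha> x
      + x powr (1 - \<alpha>) * (M - W x) / \<alpha>)) at_top at_top"
  shows "lyapunov_condition (cbc_operator b c \<mu> g W) W"
proof -
  let ?L = "cbc_operator b c \<mu> g W"
  let ?A = "\<lambda>x. g x * d x - c\<^sub>0 * (x * d x * power_primitive \<alpha> x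
      + x powr (1 - \<alpha>) * (M - W x) / \<alpha>)"
  have "0 \<le> C" using d_le[of 0] by simp
  have lin: "- (b * x * d x) \<le> \<bar>b\<bar> * C" if "0 \<le> x" for x
  proof -
    have "- (b * x * d x) \<le> \<bar>b\<bar> * (x * d x)"
      using d_nonneg[OF that] that mult_right_mono[of "- b" "\<bar>b\<bar>" "x * d x"]
      by (simp add: mult.assoc)
    also have "\<dots> \<le> \<bar>b\<bar> * C"
      by (intro mult_left_mono d_le that) auto
    finally show ?thesis .
  qed
  show ?thesis
  proof (rule lyapunov_conditionI)
    \<comment> \<open>Cut-off 1: the part governed by the slope disappears and the bound is linear in \<open>x\<close>.\<close>
    show "?L x \<le> \<bar>b\<bar> * C + (c\<^sub>0 * M / \<alpha>) * x" if "0 \<le> x" for x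
    proof -
      have "c\<^sub>0 * (M - W x) * x \<le> c\<^sub>0 * M * x"
        using W_ge_1[OF that] c0_pos that by (intro mult_right_mono mult_left_mono) auto
      then have "c\<^sub>0 * (M - W x) * x / \<alpha> \<le> c\<^sub>0 * M * x / \<alpha>"
        using alpha_pos by (intro divide_right_mono) auto
      moreover have "0 \<le> g x * d x"
        using g_nonneg d_nonneg that by simp
      ultimately show ?thesis
        using cbc_operator_le[OF that order_refl, of b] lin[OF that]
        by (simp add: algebra_simps)
    qed
    \<comment> \<open>Cut-off \<open>x\<close>.\<close>
    have "- (\<bar>b\<bar> * C) + ?A x \<le> - ?L x" if "1 \<le> x" for x
    proof -
      have "x powr (1 - \<alpha>) = x * x powr (- \<alpha>)"
        using that powr_mult_base[of x "- \<alpha>"] by simp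
      then have "x * (c\<^sub>0 * (d x * power_primitive \<alpha> x + (M - W x) * x powr (- \<alpha>) / \<alpha>))
         = c\<^sub>0 * (x * d x * power_primitive \<alpha> x + x powr (1 - \<alpha>) * (M - W x) / \<alpha>)"
        by (simp add: distrib_left mult_ac)
      moreover have "- (b * x + g x) * d x = - (b * x * d x) - g x * d x"
        by (simp add: algebra_simps)
      ultimately show ?thesis
        using cbc_operator_le[of x x b] lin[of x] that by linarith
    qed
    then have "\<forall>\<^sub>F x in at_top. - (\<bar>b\<bar> * C) + ?A x \<le> - ?L x"
      by (rule eventually_at_top_linorderI)
    then show "filterlim (\<lambda>x. - ?L x) at_top at_top"
      by (rule filterlim_at_top_mono[OF filterlim_tendsto_add_at_top[OF tendsto_const lim]])
  qed (use \<open>0 \<le> C\<close> alpha_pos c0_pos M_ge_1 W_le in auto)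
qed

section \<open>Concave test functions\<close>

text \<open>The derivative of \<open>W\<close> is the mean of \<open>\<psi>\<close> over \<open>[x - 1, x]\<close>.  Being a difference of
  antiderivatives, it is continuously differentiable with bounded derivative although \<open>\<psi>\<close> is merely
  continuous, and monotonicity of \<open>\<psi>\<close> sandwiches it between \<open>\<psi> x\<close> and \<open>\<psi> (x - 1)\<close>.  Averaging to the
  left is essential: the mean over \<open>[x, x + 1]\<close> could be much smaller than \<open>\<psi> x\<close>.\<close>

lemma smoothed_concave_function:
  fixes \<psi> :: "real \<Rightarrow> real"
  assumes cont: "continuous_on UNIV \<psi>" and anti: "\<And>x y. x \<le> y \<Longrightarrow> \<psi> y \<le> \<psi> x"
    and pos: "\<And>x. 0 \<le> \<psi> x"
    and int: "set_integrable lborel {1..} \<psi>"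
  obtains W d M where
    "concave_test_function W d (\<lambda>x. \<psi> x - \<psi> (x - 1)) M (\<psi> (- 1))"
    "\<And>x. \<psi> x \<le> d x" "\<And>x. d x \<le> \<psi> (x - 1)"
proof -
  obtain \<Psi> where \<Psi>: "\<And>x. (\<Psi> has_real_derivative \<psi> x) (at x)"
    using real_antiderivative[OF cont] by blast
  define d where "d x = \<Psi> x - \<Psi> (x - 1)" for x
  have d: "(d has_real_derivative \<psi> x - \<psi> (x - 1)) (at x)" for x
  proof -
    have "((\<lambda>x. \<Psi> (x - 1)) has_real_derivative \<psi> (x - 1) * 1) (at x)"
      by (rule DERIV_chain'[OF _ \<Psi>]) (auto intro!: derivative_eq_intros)
    then show ?thesis
      unfolding d_def[abs_def] by (auto intro!: derivative_eq_intros \<Psi>)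
  qed
  have d_bounds: "\<psi> x \<le> d x" "d x \<le> \<psi> (x - 1)" for x
  proof -
    obtain \<xi> where "x - 1 < \<xi>" "\<xi> < x" "\<Psi> x - \<Psi> (x - 1) = (x - (x - 1)) * \<psi> \<xi>"
      using MVT2[of "x - 1" x \<Psi> \<psi>] \<Psi> by auto
    then show "\<psi> x \<le> d x" "d x \<le> \<psi> (x - 1)"
      using anti[of \<xi> x] anti[of "x - 1" \<xi>] by (auto simp: d_def)
  qed
  have "continuous_on UNIV d"
    by (intro DERIV_continuous_on[of _ _ "\<lambda>x. \<psi> x - \<psi> (x - 1)"] d)
  then obtain V where V: "\<And>x. (V has_real_derivative d x) (at x)"
    using real_antiderivative by blast
  define W where "W x = 1 + V x - V 0" for x
  have W: "(W has_real_derivative d x) (at x)" for x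
    unfolding W_def[abs_def] by (auto intro!: derivative_eq_intros V)
  define I where "I = (LINT x:{1..}|lborel. \<psi> x)"
  have \<Psi>_le: "\<Psi> y \<le> \<Psi> 1 + I" for y
  proof (cases "1 \<le> y")
    case True
    have "\<Psi> y - \<Psi> 1 = (LINT x:{1..y}|lborel. \<psi> x)"
      unfolding set_lebesgue_integral_def using True
      by (intro integral_FTC_atLeastAtMost[symmetric])
         (auto intro: continuous_on_subset[OF cont] has_field_derivative_at_within[OF \<Psi>]
               simp flip: has_real_derivative_iff_has_vector_derivative)
    also have "\<dots> \<le> I"
      unfolding I_def using pos set_integrable_subset[OF int, of "{1..y}"] int
      unfolding set_lebesgue_integral_def set_integrable_def
      by (intro integral_mono) (auto simp: indicator_def)
    finally show ?thesis by simp
  next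
    case False
    then have "y \<le> 1" by simp
    then have "\<Psi> y \<le> \<Psi> 1"
    proof (rule DERIV_nonneg_imp_nondecreasing)
      show "\<exists>D. (\<Psi> has_real_derivative D) (at x) \<and> 0 \<le> D" for x
        using \<Psi>[of x] pos[of x] by blast
    qed
    moreover have "0 \<le> I"
      unfolding I_def set_lebesgue_integral_def using pos
      by (intro Bochner_Integration.integral_nonneg) (auto simp: indicator_def)
    ultimately show ?thesis by simp
  qed
  \<comment> \<open>As \<open>W' \<le> \<psi> (x - 1)\<close>, the function \<open>W\<close> grows no more than \<open>\<Psi> (x - 1)\<close>, which is bounded above.\<close>
  have W_le: "W x \<le> 1 + I + \<Psi> 1 - \<Psi> (- 1)" if "0 \<le> x" for x
  proof -
    have der: "((\<lambda>x. W x - \<Psi> (x - 1)) has_real_derivative d y - \<psi> (y - 1) * 1) (at y)" for y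
      by (intro DERIV_diff W DERIV_chain'[OF _ \<Psi>]) (auto intro!: derivative_eq_intros)
    have "W x - \<Psi> (x - 1) \<le> W 0 - \<Psi> (0 - 1)"
    proof (rule DERIV_nonpos_imp_nonincreasing[OF that])
      fix y
      show "\<exists>D. ((\<lambda>x. W x - \<Psi> (x - 1)) has_real_derivative D) (at y) \<and> D \<le> 0"
        using der[of y] d_bounds(2)[of y] by (intro exI[of _ "d y - \<psi> (y - 1) * 1"]) simp
    qed
    then show ?thesis
      using \<Psi>_le[of "x - 1"] by (simp add: W_def)
  qed
  have "concave_test_function W d (\<lambda>x. \<psi> x - \<psi> (x - 1)) (1 + I + \<Psi> 1 - \<Psi> (- 1)) (\<psi> (- 1))"
  proof
    fix x :: real assume "0 \<le> x"
    show "(W has_real_derivative d x) (at x within {0..})"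
      "(d has_real_derivative \<psi> x - \<psi> (x - 1)) (at x within {0..})"
      by (rule has_field_derivative_at_within[OF W] has_field_derivative_at_within[OF d])+
    show "0 \<le> d x"
      using pos[of x] d_bounds(1)[of x] by simp
    show "\<psi> x - \<psi> (x - 1) \<le> 0"
      using anti[of "x - 1" x] by simp
    show "- \<psi> (- 1) \<le> \<psi> x - \<psi> (x - 1)"
      using anti[of "- 1" "x - 1"] pos[of x] \<open>0 \<le> x\<close> by simp
    show "W x \<le> 1 + I + \<Psi> 1 - \<Psi> (- 1)"
      by (rule W_le) fact
  next
    show "continuous_on {0..} (\<lambda>x. \<psi> x - \<psi> (x - 1))"
      by (intro continuous_intros continuous_on_subset[OF cont] continuous_on_compose2[OF cont]) auto
    show "1 \<le> W 0"
      by (simp add: W_def)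
  qed
  then show thesis
    using that d_bounds by blast
qed

lemma powr_concave_test_function:
  fixes \<alpha> :: real
  assumes "0 < \<alpha>" "\<alpha> < 1"
  shows "concave_test_function (\<lambda>x. 2 - (1 + x) powr (\<alpha> - 1)) (\<lambda>x. (1 - \<alpha>) * (1 + x) powr (\<alpha> - 2))
    (\<lambda>x. - ((1 - \<alpha>) * (2 - \<alpha>) * (1 + x) powr (\<alpha> - 3))) 2 ((1 - \<alpha>) * (2 - \<alpha>))"
proof
  fix x :: real assume "0 \<le> x"
  have eqs: "\<alpha> - 1 - 1 = \<alpha> - 2" "\<alpha> - 2 - 1 = \<alpha> - 3" by auto
  show "((\<lambda>x. 2 - (1 + x) powr (\<alpha> - 1)) has_real_derivative (1 - \<alpha>) * (1 + x) powr (\<alpha> - 2))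
      (at x within {0..})"
    using \<open>0 \<le> x\<close> by (auto intro!: derivative_eq_intros simp: eqs algebra_simps)
  show "((\<lambda>x. (1 - \<alpha>) * (1 + x) powr (\<alpha> - 2)) has_real_derivative
      - ((1 - \<alpha>) * (2 - \<alpha>) * (1 + x) powr (\<alpha> - 3))) (at x within {0..})"
    using \<open>0 \<le> x\<close> by (auto intro!: derivative_eq_intros simp: eqs algebra_simps)
  have "(1 + x) powr (\<alpha> - 3) \<le> (1 + x) powr 0"
    using \<open>0 \<le> x\<close> assms by (intro powr_mono) auto
  then have "(1 - \<alpha>) * (2 - \<alpha>) * (1 + x) powr (\<alpha> - 3) \<le> (1 - \<alpha>) * (2 - \<alpha>) * 1"
    using \<open>0 \<le> x\<close> assms by (intro mult_left_mono) auto
  then show "- ((1 - \<alpha>) * (2 - \<alpha>)) \<le> - ((1 - \<alpha>) * (2 - \<alpha>) * (1 + x) powr (\<alpha> - 3))"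
    by simp
qed (use assms in \<open>auto intro!: continuous_intros\<close>)

section \<open>The drift dominates the jumps\<close>

text \<open>For \<open>\<alpha> > 1\<close> the primitive of \<open>z powr (- \<alpha>)\<close> is bounded.\<close>

lemma drift_domination_gt_1:
  fixes \<alpha> A B :: real and w :: "real \<Rightarrow> real"
  assumes "1 < \<alpha>" and "filterlim w at_top at_top"
  shows "filterlim (\<lambda>x. w x - A * power_primitive \<alpha> x - B) at_top at_top"
proof (rule filterlim_at_top_mono)
  show "filterlim (\<lambda>x. - (\<bar>A\<bar> / (\<alpha> - 1) + B) + w x) at_top at_top"
    by (intro filterlim_tendsto_add_at_top[OF tendsto_const] assms)
  have "- (\<bar>A\<bar> / (\<alpha> - 1) + B) + w x \<le> w x - A * power_primitive \<alpha> x - B" if "1 \<le> x" for x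
  proof -
    have "power_primitive \<alpha> x = (1 - x powr (1 - \<alpha>)) / (\<alpha> - 1)"
      using \<open>1 < \<alpha>\<close> by (simp add: power_primitive_def divide_simps) (simp add: algebra_simps)
    also have "\<dots> \<le> 1 / (\<alpha> - 1)"
      using \<open>1 < \<alpha>\<close> by (intro divide_right_mono) auto
    finally have "A * power_primitive \<alpha> x \<le> \<bar>A\<bar> * (1 / (\<alpha> - 1))"
      using power_primitive_nonneg[OF that, of \<alpha>] by (intro mult_mono) auto
    then show ?thesis by simp
  qed
  then show "\<forall>\<^sub>F x in at_top. - (\<bar>A\<bar> / (\<alpha> - 1) + B) + w x \<le> w x - A * power_primitive \<alpha> x - B"
    by (rule eventually_at_top_linorderI)
qed

text \<open>For \<open>\<alpha> = 1\<close> the primitive is \<open>ln\<close>, and \<open>w / ln\<close> eventually exceeds \<open>A + 1\<close>, which leaves a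
  surplus of \<open>ln x\<close>.\<close>

lemma drift_domination_eq_1:
  fixes \<alpha> A B :: real and w :: "real \<Rightarrow> real"
  assumes "\<alpha> = 1" and "filterlim (\<lambda>x. w x / ln x) at_top at_top"
  shows "filterlim (\<lambda>x. w x - A * power_primitive \<alpha> x - B) at_top at_top"
proof (rule filterlim_at_top_mono)
  show "filterlim (\<lambda>x::real. - B + ln x) at_top at_top"
    by (intro filterlim_tendsto_add_at_top[OF tendsto_const] ln_at_top)
  have "\<forall>\<^sub>F x in at_top. A + 1 \<le> w x / ln x"
    using assms(2) by (simp add: filterlim_at_top)
  then show "\<forall>\<^sub>F x in at_top. - B + ln x \<le> w x - A * power_primitive \<alpha> x - B"
    using eventually_gt_at_top[of 1]
  proof eventually_elim
    case (elim x)
    then have "(A + 1) * ln x \<le> w x"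
      by (simp add: pos_le_divide_eq)
    then show ?case
      using \<open>\<alpha> = 1\<close> by (simp add: power_primitive_def algebra_simps)
  qed
qed

context cbc_power_tail
begin

text \<open>For \<open>\<alpha> \<ge> 1\<close> the uniform part of the jump bound contributes at most a constant, since
  \<open>x powr (1 - \<alpha>) \<le> 1\<close>, and \<open>x * W'(x)\<close> is bounded because \<open>\<phi>\<close> is bounded away from 0.  So the drift only
  has to beat a multiple of \<open>power_primitive\<close>, with constants \<open>A\<close> and \<open>B\<close> that depend on the \<open>W\<close>
  constructed in the proof.\<close>

lemma lyapunov_of_integrable_weight:
  fixes \<phi> :: "real \<Rightarrow> real"
  assumes cont: "continuous_on {0..} \<phi>" and mono: "mono_on {0..} \<phi>"
    and pos: "\<And>x. 0 \<le> x \<Longrightarrow> 0 < \<phi> x"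
    and int: "set_integrable lborel {1..} (\<lambda>r. 1 / (r * \<phi> r))"
    and lim: "\<And>A B. filterlim (\<lambda>x. g x / (x * \<phi> x) - A * power_primitive \<alpha> x - B) at_top at_top"
    and "1 \<le> \<alpha>"
  shows "\<exists>W\<in>Cb2_halfline. (\<forall>x\<ge>0. 1 \<le> W x) \<and> lyapunov_condition (cbc_operator b c \<mu> g W) W"
proof -
  \<comment> \<open>The weight \<open>1 / (u \<phi>(u))\<close>, kept constant to the left of 1 so that it is bounded, monotone and defined
    on the whole line.\<close>
  define \<psi> where "\<psi> u = 1 / (max 1 u * \<phi> (max 1 u))" for u
  have \<phi>_mono: "\<phi> x \<le> \<phi> y" if "0 \<le> x" "x \<le> y" for x y
    using mono_onD[OF mono, of x y] that by simp
  have "continuous_on UNIV \<psi>"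
    unfolding \<psi>_def[abs_def] using pos
    by (intro continuous_intros continuous_on_compose2[OF cont]) (auto simp: less_imp_neq[symmetric])
  moreover have "\<psi> y \<le> \<psi> x" if "x \<le> y" for x y
    unfolding \<psi>_def using that pos
    by (intro divide_left_mono mult_mono mult_pos_pos \<phi>_mono) (auto intro: less_imp_le)
  moreover have "0 \<le> \<psi> x" for x
    unfolding \<psi>_def by (intro divide_nonneg_nonneg mult_nonneg_nonneg less_imp_le[OF pos]) auto
  moreover have "set_integrable lborel {1..} \<psi>"
    using int by (rule set_integrable_cong[THEN iffD1, rotated -1]) (auto simp: \<psi>_def)
  ultimately obtain W d M where
    conc: "concave_test_function W d (\<lambda>x. \<psi> x - \<psi> (x - 1)) M (\<psi> (- 1))"
    and d: "\<And>x. \<psi> x \<le> d x" "\<And>x. d x \<le> \<psi> (x - 1)"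
    using smoothed_concave_function by blast
  interpret concave_test_function W d "\<lambda>x. \<psi> x - \<psi> (x - 1)" M "\<psi> (- 1)"
    by (rule conc)
  interpret cbc_concave c \<mu> g \<alpha> c\<^sub>0 p W d "\<lambda>x. \<psi> x - \<psi> (x - 1)" M "\<psi> (- 1)" ..
  define C where "C = 2 / \<phi> 0"
  have xd_le: "x * d x \<le> C" if "0 \<le> x" for x
  proof -
    \<comment> \<open>The shift by 1 in the upper bound for \<open>d\<close> costs at most a factor 2.\<close>
    define m where "m = max 1 (x - 1)"
    have m: "1 \<le> m" "x \<le> 2 * m" by (auto simp: m_def max_def)
    have "x * d x \<le> x * \<psi> (x - 1)"
      using that d by (intro mult_left_mono)
    also have "\<dots> = x / (m * \<phi> m)"
      by (simp add: \<psi>_def m_def)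
    also have "\<dots> \<le> (2 * m) / (m * \<phi> 0)"
      using m that pos[of m] pos[of 0] \<phi>_mono[of 0 m] by (intro frac_le mult_left_mono) auto
    also have "\<dots> = C"
      using m by (simp add: C_def)
    finally show ?thesis .
  qed
  have "filterlim (\<lambda>x. g x * d x - c\<^sub>0 * (x * d x * power_primitive \<alpha> x
      + x powr (1 - \<alpha>) * (M - W x) / \<alpha>)) at_top at_top"
  proof (rule filterlim_at_top_mono[OF lim])
    have "g x / (x * \<phi> x) - (c\<^sub>0 * C) * power_primitive \<alpha> x - c\<^sub>0 * (M / \<alpha>)
      \<le> g x * d x - c\<^sub>0 * (x * d x * power_primitive \<alpha> x + x powr (1 - \<alpha>) * (M - W x) / \<alpha>)"
      if "1 \<le> x" for x
    proof -
      have "g x * \<psi> x \<le> g x * d x"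
        using g_nonneg that by (intro mult_left_mono d) auto
      moreover have "g x * \<psi> x = g x / (x * \<phi> x)"
        using that by (simp add: \<psi>_def)
      moreover have "x * d x * power_primitive \<alpha> x \<le> C * power_primitive \<alpha> x"
        using that by (intro mult_right_mono xd_le power_primitive_nonneg) auto
      moreover have "x powr (1 - \<alpha>) * (M - W x) / \<alpha> \<le> 1 * M / \<alpha>"
        using that \<open>1 \<le> \<alpha>\<close> W_le[of x] W_ge_1[of x] powr_mono[of "1 - \<alpha>" 0 x]
        by (intro divide_right_mono mult_mono) auto
      ultimately have "c\<^sub>0 * (x * d x * power_primitive \<alpha> x + x powr (1 - \<alpha>) * (M - W x) / \<alpha>)
          \<le> c\<^sub>0 * (C * power_primitive \<alpha> x + M / \<alpha>)" "g x / (x * \<phi> x) \<le> g x * d x"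
        using c0_pos by (auto intro!: mult_left_mono add_mono)
      then show ?thesis
        by (simp add: algebra_simps)
    qed
    then show "\<forall>\<^sub>F x in at_top. g x / (x * \<phi> x) - (c\<^sub>0 * C) * power_primitive \<alpha> x - c\<^sub>0 * (M / \<alpha>)
      \<le> g x * d x - c\<^sub>0 * (x * d x * power_primitive \<alpha> x + x powr (1 - \<alpha>) * (M - W x) / \<alpha>)"
      by (rule eventually_at_top_linorderI)
  qed
  then have "lyapunov_condition (cbc_operator b c \<mu> g W) W"
    by (intro lyapunov_of_drift_domination[of C] xd_le)
  then show ?thesis
    using W_in_Cb2 W_ge_1 by blast
qed

text \<open>Both jump contributions are bounded: \<open>x W'(x)\<close> decays like \<open>x powr (\<alpha> - 1)\<close>, which offsets the
  growth \<open>x powr (1 - \<alpha>)\<close> of the primitive, and \<open>2 - W x\<close> decays at the same rate.\<close>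

lemma lyapunov_alpha_lt_1:
  assumes "\<alpha> < 1" and lim: "filterlim (\<lambda>x. g x / x powr (2 - \<alpha>)) at_top at_top"
  shows "\<exists>W\<in>Cb2_halfline. (\<forall>x\<ge>0. 1 \<le> W x) \<and> lyapunov_condition (cbc_operator b c \<mu> g W) W"
proof -
  let ?W = "\<lambda>x. 2 - (1 + x) powr (\<alpha> - 1)"
  let ?d = "\<lambda>x. (1 - \<alpha>) * (1 + x) powr (\<alpha> - 2)"
  let ?e = "\<lambda>x. - ((1 - \<alpha>) * (2 - \<alpha>) * (1 + x) powr (\<alpha> - 3))"
  interpret concave_test_function ?W ?d ?e 2 "(1 - \<alpha>) * (2 - \<alpha>)"
    using alpha_pos \<open>\<alpha> < 1\<close> by (rule powr_concave_test_function)
  interpret cbc_concave c \<mu> g \<alpha> c\<^sub>0 p ?W ?d ?e 2 "(1 - \<alpha>) * (2 - \<alpha>)" ..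
  have cancel: "x powr (1 - \<alpha>) * x powr (\<alpha> - 1) = 1" if "0 < x" for x :: real
    using that by (simp flip: powr_add)
  have xd_le: "x * ?d x \<le> 1" if "0 \<le> x" for x
  proof -
    have "x * ?d x \<le> (1 + x) * (1 * (1 + x) powr (\<alpha> - 2))"
      using that alpha_pos \<open>\<alpha> < 1\<close> by (intro mult_mono) auto
    also have "\<dots> = (1 + x) powr (\<alpha> - 1)"
      using that powr_mult_base[of "1 + x" "\<alpha> - 2"] by simp
    also have "\<dots> \<le> (1 + x) powr 0"
      using that \<open>\<alpha> < 1\<close> by (intro powr_mono) auto
    finally show ?thesis
      using that by simp
  qed
  define k where "k = (1 - \<alpha>) * 2 powr (\<alpha> - 2)"
  have "0 < k" using \<open>\<alpha> < 1\<close> by (simp add: k_def)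
  have "filterlim (\<lambda>x. g x * ?d x - c\<^sub>0 * (x * ?d x * power_primitive \<alpha> x
      + x powr (1 - \<alpha>) * (2 - ?W x) / \<alpha>)) at_top at_top"
  proof (rule filterlim_at_top_mono)
    show "filterlim (\<lambda>x. - (c\<^sub>0 * (1 + 1 / \<alpha>)) + k * (g x / x powr (2 - \<alpha>))) at_top at_top"
      by (intro filterlim_tendsto_add_at_top[OF tendsto_const]
            filterlim_tendsto_pos_mult_at_top[OF tendsto_const \<open>0 < k\<close> lim])
    have "- (c\<^sub>0 * (1 + 1 / \<alpha>)) + k * (g x / x powr (2 - \<alpha>))
      \<le> g x * ?d x - c\<^sub>0 * (x * ?d x * power_primitive \<alpha> x + x powr (1 - \<alpha>) * (2 - ?W x) / \<alpha>)"
      if "1 \<le> x" for x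
    proof -
      have decr: "(1 + x) powr a \<le> x powr a" if "a \<le> 0" for a
        using that \<open>1 \<le> x\<close> by (intro powr_mono2') auto
      have "(2 * x) powr (\<alpha> - 2) \<le> (1 + x) powr (\<alpha> - 2)"
        using that \<open>\<alpha> < 1\<close> by (intro powr_mono2') auto
      then have "g x * ((1 - \<alpha>) * (2 * x) powr (\<alpha> - 2)) \<le> g x * ?d x"
        using that \<open>\<alpha> < 1\<close> g_nonneg by (intro mult_left_mono) auto
      moreover have "g x * ((1 - \<alpha>) * (2 * x) powr (\<alpha> - 2)) = k * (g x / x powr (2 - \<alpha>))"
        using that powr_minus_divide[of x "2 - \<alpha>"] by (simp add: k_def powr_mult)
      moreover have "x * ?d x * power_primitive \<alpha> x \<le> 1"
      proof -
        have "x * ?d x * power_primitive \<alpha> x = x * (1 + x) powr (\<alpha> - 2) * (x powr (1 - \<alpha>) - 1)"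
          using \<open>\<alpha> < 1\<close> by (simp add: power_primitive_def)
        also have "\<dots> \<le> x * x powr (\<alpha> - 2) * x powr (1 - \<alpha>)"
          using that \<open>\<alpha> < 1\<close> by (intro mult_mono decr) (auto simp: ge_one_powr_ge_zero)
        also have "\<dots> = 1"
          using that powr_mult_base[of x "\<alpha> - 2"] cancel[of x] by (simp add: mult.commute)
        finally show ?thesis .
      qed
      moreover have "x powr (1 - \<alpha>) * (2 - ?W x) / \<alpha> \<le> 1 / \<alpha>"
      proof -
        have "x powr (1 - \<alpha>) * (1 + x) powr (\<alpha> - 1) \<le> x powr (1 - \<alpha>) * x powr (\<alpha> - 1)"
          using \<open>\<alpha> < 1\<close> by (intro mult_left_mono decr) auto
        then show ?thesis
          using alpha_pos cancel[of x] that by (intro divide_right_mono) auto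
      qed
      ultimately have "k * (g x / x powr (2 - \<alpha>)) \<le> g x * ?d x"
        "c\<^sub>0 * (x * ?d x * power_primitive \<alpha> x + x powr (1 - \<alpha>) * (2 - ?W x) / \<alpha>) \<le> c\<^sub>0 * (1 + 1 / \<alpha>)"
        using c0_pos by (simp_all only: mult_left_mono add_mono less_imp_le)
      then show ?thesis
        by linarith
    qed
    then show "\<forall>\<^sub>F x in at_top. - (c\<^sub>0 * (1 + 1 / \<alpha>)) + k * (g x / x powr (2 - \<alpha>))
      \<le> g x * ?d x - c\<^sub>0 * (x * ?d x * power_primitive \<alpha> x + x powr (1 - \<alpha>) * (2 - ?W x) / \<alpha>)"
      by (rule eventually_at_top_linorderI)
  qed
  then have "lyapunov_condition (cbc_operator b c \<mu> g ?W) ?W"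
    by (intro lyapunov_of_drift_domination[of 1] xd_le)
  then show ?thesis
    by (intro bexI[of _ ?W] conjI allI impI W_in_Cb2 W_ge_1)
qed

end

theorem proposition1p5:
  fixes b c \<alpha> c\<^sub>0 :: real
    and \<mu> :: "real measure"
    and g \<phi> :: "real \<Rightarrow> real"
    and p :: "real \<Rightarrow> ennreal"
  assumes "cbc_parameters c \<mu> g"
    and "0 < \<alpha>" and "\<alpha> < 2" and "0 < c\<^sub>0"
    and "p \<in> borel_measurable (restrict_space lborel {1<..})"
    and "restrict_space \<mu> {1<..} = density (restrict_space lborel {1<..}) p"
    and "AE z in restrict_space lborel {1<..}. p z \<le> ennreal (c\<^sub>0 * z powr (- 1 - \<alpha>))"
    and "\<phi> \<in> C1_halfline"
    and "mono_on {0..} \<phi>"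
    and "\<And>x. 0 \<le> x \<Longrightarrow> 0 < \<phi> x"
    and "set_integrable lborel {1..} (\<lambda>r. 1 / (r * \<phi> r))"
    and "1 < \<alpha> \<Longrightarrow> filterlim (\<lambda>x. g x / (x * \<phi> x)) at_top at_top"
    and "\<alpha> = 1 \<Longrightarrow> filterlim (\<lambda>x. g x / (x * \<phi> x * ln x)) at_top at_top"
    and "\<alpha> < 1 \<Longrightarrow> filterlim (\<lambda>x. g x / x powr (2 - \<alpha>)) at_top at_top"
  shows "\<exists>W \<in> Cb2_halfline. (\<forall>x\<ge>0. 1 \<le> W x) \<and>
    (\<exists>(r :: nat \<Rightarrow> real) (\<beta> :: nat \<Rightarrow> real) (K :: nat \<Rightarrow> real set).
      (\<forall>n\<ge>1. 0 < r n) \<and> (\<forall>n\<ge>1. 0 < \<beta> n) \<and> filterlim r at_top sequentially \<and>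
      (\<forall>n\<ge>1. compact (K n) \<and> K n \<subseteq> {0..} \<and> K n \<subseteq> K (Suc n)) \<and>
      (\<forall>n\<ge>1. \<forall>x\<ge>0.
        - cbc_operator b c \<mu> g W x \<ge> r n * W x - \<beta> n * indicator (K n) x))"
proof -
  interpret cbc_power_tail c \<mu> g \<alpha> c\<^sub>0 p
    using assms(1,2,4-7) by (simp add: cbc_power_tail_def cbc_power_tail_axioms_def)
  have cont: "continuous_on {0..} \<phi>"
    using \<open>\<phi> \<in> C1_halfline\<close> by (auto simp: C1_halfline_def differentiable_imp_continuous_on)
  note weight = lyapunov_of_integrable_weight[OF cont assms(9-11)]
  have "\<exists>W\<in>Cb2_halfline. (\<forall>x\<ge>0. 1 \<le> W x) \<and> lyapunov_condition (cbc_operator b c \<mu> g W) W"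
  proof (cases \<alpha> "1 :: real" rule: linorder_cases)
    case less
    then show ?thesis
      using assms(14) by (intro lyapunov_alpha_lt_1)
  next
    case equal
    then show ?thesis
      using assms(13) by (intro weight drift_domination_eq_1) auto
  next
    case greater
    then show ?thesis
      using assms(12) by (intro weight drift_domination_gt_1) auto
  qed
  then show ?thesis
    unfolding lyapunov_condition_def .
qed

end
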